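(* Let $\mathcal{A} = \{A_1, A_2, \ldots, A_m\}$ be linearly independent in $\mathcal{D}_n$, where $A_k = ((a_{11}^k, a_{22}^k, \ldots, a_{nn}^k))$ for each $1 \le k \le m$. Suppose that the $i_1$-th, $i_2$-th, $\ldots$, $i_p$-th components form a complete list of pairwise nonequivalent components satisfying the $*$-Property (that is, each satisfies the $*$-Property, they are pairwise nonequivalent, and every component satisfying the $*$-Property is equivalent to one of them). Then $\mathrm{span}\{A_1, A_2, \ldots, A_m\}$ is a co-Chebyshev subspace of $\mathcal{M}_n$ if and only if $p = m$ and $|P_{i_s}^+ \cup P_{i_s}^-| = 1$ for all $s \in \{1, 2, \ldots, p\}$.
   Context: $\mathcal{M}_n$ is the space of $n \times n$ real matrices with the operator norm induced by the Euclidean norm on $\mathbb{R}^n$, and $\mathcal{D}_n \subset \mathcal{M}_n$ is the subspace of diagonal matrices; $((a_{11}, \ldots, a_{nn}))$ denotes the diagonal matrix with these diagonal entries. For a subspace $\mathbb{Y}$ of a Banach space $\mathbb{X}$ and $x \in \mathbb{X}$, $y_0 \in \mathbb{Y}$ is a best coapproximation to $x$ out of $\mathbb{Y}$ if $\|y_0 - y\| \le \|x - y\|$ for all $y \in \mathbb{Y}$. The subspace $\mathbb{Y}$ is coproximinal in $\mathbb{X}$ if every element of $\mathbb{X}$ has a best coapproximation out of $\mathbb{Y}$, and co-Chebyshev if moreover this best coapproximation is unique for every element of $\mathbb{X}$. For $\mathcal{A}$ as in the claim and $i \in \{1, \ldots, n\}$: the $i$-th component (of $\mathcal{A}$) is the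 vector $(a_{ii}^1, a_{ii}^2, \ldots, a_{ii}^m) \in \mathbb{R}^m$. The $i$-th and $j$-th components are equivalent if $(a_{ii}^1, \ldots, a_{ii}^m) = \pm (a_{jj}^1, \ldots, a_{jj}^m)$, and nonequivalent otherwise. Put $P_i^+ = \{j \in \{1,\ldots,n\} : (a_{jj}^1, \ldots, a_{jj}^m) = (a_{ii}^1, \ldots, a_{ii}^m)\}$ and $P_i^- = \{j \in \{1,\ldots,n\} : (a_{jj}^1, \ldots, a_{jj}^m) = -(a_{ii}^1, \ldots, a_{ii}^m)\}$. The $i$-th component satisfies the $*$-Property if there exist $\beta_1, \ldots, \beta_m \in \mathbb{R}$ such that $|\sum_{k=1}^m \beta_k a_{ii}^k| > \max\{|\sum_{k=1}^m \beta_k a_{jj}^k| : 1 \le j \le n,\ j \notin P_i^+ \cup P_i^-\}$ (if no such $j$ exists, the condition is regarded as satisfied). *)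

theory Defs
  imports "HOL-Analysis.Analysis"
begin

text \<open>
  The library norm on the type \<open>real^'n^'n\<close> is the Euclidean (Frobenius) norm, not the operator
  norm.  The notions of best coapproximation are therefore stated with the norm as an explicit
  parameter \<open>N\<close>; the ambient space is the whole type.
\<close>

definition op_norm :: "real^'n^'n \<Rightarrow> real" where
  "op_norm M = onorm (\<lambda>x. M *v x)"

definition best_coapproximation :: "('a::real_vector \<Rightarrow> real) \<Rightarrow> 'a set \<Rightarrow> 'a \<Rightarrow> 'a \<Rightarrow> bool" where
  "best_coapproximation N Y x y0 \<longleftrightarrow> y0 \<in> Y \<and> (\<forall>y\<in>Y. N (y0 - y) \<le> N (x - y))"

definition coproximinal :: "('a::real_vector \<Rightarrow> real) \<Rightarrow> 'a set \<Rightarrow> bool" where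
  "coproximinal N Y \<longleftrightarrow> subspace Y \<and> (\<forall>x. \<exists>y0. best_coapproximation N Y x y0)"

definition co_Chebyshev :: "('a::real_vector \<Rightarrow> real) \<Rightarrow> 'a set \<Rightarrow> bool" where
  "co_Chebyshev N Y \<longleftrightarrow> coproximinal N Y \<and> (\<forall>x. \<exists>!y0. best_coapproximation N Y x y0)"

definition diagonal_matrices :: "(real^'n^'n) set" where
  "diagonal_matrices = {M. \<forall>i j. i \<noteq> j \<longrightarrow> M $ i $ j = 0}"

text \<open>
  A family \<open>A\<^sub>1, \<dots>, A\<^sub>m\<close> of matrices is a function on a finite index type \<open>'m\<close>, so that
  \<open>m = CARD('m) \<ge> 1\<close> and the components are vectors in \<open>real^'m\<close>.
\<close>

definition ith_component :: "('m \<Rightarrow> real^'n^'n) \<Rightarrow> 'n \<Rightarrow> real^'m" where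
  "ith_component A i = (\<chi> k. A k $ i $ i)"

definition equivalent_components :: "('m::finite \<Rightarrow> real^'n^'n) \<Rightarrow> 'n \<Rightarrow> 'n \<Rightarrow> bool" where
  "equivalent_components A i j \<longleftrightarrow>
     ith_component A i = ith_component A j \<or> ith_component A i = - ith_component A j"

definition P_plus :: "('m::finite \<Rightarrow> real^'n^'n) \<Rightarrow> 'n \<Rightarrow> 'n set" where
  "P_plus A i = {j. ith_component A j = ith_component A i}"

definition P_minus :: "('m::finite \<Rightarrow> real^'n^'n) \<Rightarrow> 'n \<Rightarrow> 'n set" where
  "P_minus A i = {j. ith_component A j = - ith_component A i}"

text \<open>The case of an empty index set is separate because \<open>Max {}\<close> is unspecified.\<close>

definition star_property :: "('m::finite \<Rightarrow> real^'n^'n) \<Rightarrow> 'n \<Rightarrow> bool" where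
  "star_property A i \<longleftrightarrow>
     - (P_plus A i \<union> P_minus A i) = {} \<or>
     (\<exists>\<beta> :: 'm \<Rightarrow> real.
        \<bar>\<Sum>k\<in>UNIV. \<beta> k * ith_component A i $ k\<bar> >
        Max ((\<lambda>j. \<bar>\<Sum>k\<in>UNIV. \<beta> k * ith_component A j $ k\<bar>) ` (- (P_plus A i \<union> P_minus A i))))"

end

theory Submission
  imports Defs
begin

text \<open>
  Write \<open>v\<^sub>j\<close> for the \<open>j\<close>-th component and \<open>D(\<beta>)\<close> for the combination of the \<open>A\<^sub>k\<close> with coefficient
  vector \<open>\<beta>\<close>.  Then \<open>D(\<beta>)\<close> is diagonal with entries \<open>\<beta> \<bullet> v\<^sub>j\<close>, so the span is \<open>real^'m\<close> under the
  polyhedral norm \<open>max\<^sub>j \<bar>\<beta> \<bullet> v\<^sub>j\<bar>\<close>.  The star property says that some \<open>\<beta>\<close> attains this maximum only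
  on the class of \<open>j\<close>; geometrically, \<open>v\<^sub>j\<close> is a vertex of the polytope spanned by all \<open>\<plusminus>v\<^sub>k\<close>.  The
  vertices alone already compute the norm (\<open>star_component_dominates\<close>), hence they span \<open>real^'m\<close>
  and \<open>p \<ge> m\<close>.

  Two opposite facts decide which \<open>D(c)\<close> are best coapproximations to \<open>T\<close>.
  If a set of indices is rich enough to compute the norm, then agreement of \<open>D(c)\<close> with the diagonal
  of \<open>T\<close> on that set suffices (\<open>best_coapproximation_combI\<close>), because a diagonal entry is bounded by
  the operator norm.
  Conversely (\<open>best_coapproximation_forced\<close>), let \<open>\<beta>\<close> peak at a vertex \<open>v\<^sub>j\<close> with value 1, and let \<open>T\<close>
  have as its block on the class of \<open>j\<close> that of \<open>t D(\<beta>)\<close>, a multiple of a sign matrix.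
  The squared norm of \<open>\<rho> D(\<beta>) - T\<close> then exceeds \<open>(\<rho> - t)\<^sup>2\<close> by at most a constant independent of
  \<open>\<rho>\<close>, and comparison with \<open>(\<rho> - c \<bullet> v\<^sub>j)\<^sup>2\<close> as \<open>\<rho> \<rightarrow> \<plusminus>\<infinity>\<close> leaves only \<open>c \<bullet> v\<^sub>j = t\<close>.

  Suppose the span is co-Chebyshev.  Coapproximating the matrix that carries the signs of one
  class and vanishes elsewhere yields, by forcing, a vector dual to that vertex; so the vertices are
  linearly independent and \<open>p \<le> m\<close>.  If a class has two members, the matrix unit at one of them has
  two best coapproximations, one matching it there and one matching it at the other member.
  If, on the other hand, \<open>p = m\<close> and all classes are singletons, the vertices form a basis, so some
  \<open>D(c)\<close> matches the diagonal of any given \<open>T\<close> at all vertices, and forcing applies to every \<open>T\<close> and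
  determines \<open>c\<close>.
\<close>

section \<open>Operator norms of matrices with a diagonal leading part\<close>

lemma abs_diagonal_entry_le_op_norm: "\<bar>M $ j $ j\<bar> \<le> op_norm M"
  unfolding op_norm_def by (rule matrix_component_le_onorm)

lemma op_norm_le:
  assumes "\<And>x. norm (M *v x) \<le> b * norm x"
  shows "op_norm M \<le> b"
  unfolding op_norm_def using assms by (rule onorm_le)

lemma diagonal_mult_vec:
  assumes "D \<in> diagonal_matrices"
  shows "(D *v x) $ j = D $ j $ j * x $ j"
proof -
  have "(D *v x) $ j = (\<Sum>k\<in>UNIV. D $ j $ k * x $ k)"
    by (simp add: matrix_vector_mult_def)
  also have "\<dots> = (\<Sum>k\<in>{j}. D $ j $ k * x $ k)"
    using assms by (intro sum.mono_neutral_right) (auto simp: diagonal_matrices_def)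
  finally show ?thesis by simp
qed

lemma op_norm_diagonal_le:
  assumes "D \<in> diagonal_matrices" and "\<And>j. \<bar>D $ j $ j\<bar> \<le> q"
  shows "op_norm D \<le> q"
proof (rule op_norm_le)
  fix x
  have "0 \<le> q" using assms(2) abs_ge_zero order_trans by blast
  have "norm (D *v x) \<le> norm (q *\<^sub>R x)"
    using assms(2) \<open>0 \<le> q\<close>
    by (intro norm_le_componentwise_cart)
       (auto simp: diagonal_mult_vec[OF assms(1)] abs_mult intro!: mult_right_mono)
  then show "norm (D *v x) \<le> q * norm x" using \<open>0 \<le> q\<close> by simp
qed

text \<open>
  Split a vector as \<open>x = u + w\<close> with \<open>u\<close> supported on \<open>P\<close> and \<open>w\<close> off \<open>P\<close>.  In the expansion of
  \<open>\<parallel>(\<rho> D - T) x\<parallel>\<^sup>2\<close> the part \<open>w\<close> costs a multiple of \<open>\<rho>\<^sup>2 \<parallel>w\<parallel>\<^sup>2\<close>, since \<open>D\<close> contracts strictly off \<open>P\<close>, and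
  can gain at most a multiple of \<open>\<bar>\<rho>\<bar> \<parallel>w\<parallel> \<parallel>x\<parallel>\<close>; the net gain stays bounded as \<open>\<rho>\<close> varies.  On \<open>P\<close> the
  cross term is exactly \<open>t \<parallel>u\<parallel>\<^sup>2\<close>.
\<close>

lemma op_norm_scaled_diagonal_minus:
  fixes D T :: "real^'n^'n"
  assumes D: "D \<in> diagonal_matrices"
    and unit: "\<And>j. j \<in> P \<Longrightarrow> \<bar>D $ j $ j\<bar> = 1"
    and off: "\<And>j. j \<notin> P \<Longrightarrow> \<bar>D $ j $ j\<bar> < 1"
    and block: "\<And>j k. j \<in> P \<Longrightarrow> k \<in> P \<Longrightarrow> D $ j $ j * T $ j $ k = (if j = k then t else 0)"
  obtains K where "\<And>\<rho>. (op_norm (\<rho> *\<^sub>R D - T))\<^sup>2 \<le> (\<rho> - t)\<^sup>2 + K"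
proof -
  (* the constant 1 only keeps the set nonempty when P is everything *)
  define \<kappa> where "\<kappa> = Min (insert 1 ((\<lambda>j. 1 - (D $ j $ j)\<^sup>2) ` (- P)))"
  have \<kappa>: "\<kappa> > 0"
    unfolding \<kappa>_def using off by (auto simp: abs_square_less_1)
  have D_off: "(D $ j $ j)\<^sup>2 \<le> 1 - \<kappa>" if "j \<notin> P" for j
  proof -
    have "\<kappa> \<le> 1 - (D $ j $ j)\<^sup>2" unfolding \<kappa>_def using that by (intro Min_le) auto
    then show ?thesis by simp
  qed
  have D_le: "\<bar>D $ j $ j\<bar> \<le> 1" for j
    using unit[of j] off[of j] by force
  define C where "C = op_norm T"
  have C: "norm (T *v x) \<le> C * norm x" for x
    unfolding C_def op_norm_def by (rule onorm) simp
  have "0 \<le> C" unfolding C_def op_norm_def by (rule onorm_pos_le) simp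
  define B where "B = 2 * \<bar>t\<bar> + 4 * C"
  define K where "K = C\<^sup>2 + B\<^sup>2 / (4 * \<kappa>)"
  have K: "0 \<le> K" using \<kappa> by (simp add: K_def)
  have D_contr: "norm (D *v x) \<le> norm x" for x
    using D_le by (intro norm_le_componentwise_cart)
      (auto simp: diagonal_mult_vec[OF D] abs_mult intro: mult_left_le_one_le)
  have main: "(norm ((\<rho> *\<^sub>R D - T) *v x))\<^sup>2 \<le> ((\<rho> - t)\<^sup>2 + K) * (norm x)\<^sup>2" for \<rho> x
  proof -
    define u where "u = (\<chi> j. if j \<in> P then x $ j else 0)"
    define w where "w = (\<chi> j. if j \<in> P then 0 else x $ j)"
    have x: "x = u + w" by (simp add: u_def w_def vec_eq_iff)
    have uw: "u \<bullet> w = 0" unfolding inner_vec_def u_def w_def by (auto intro: sum.neutral)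
    have nx: "(norm x)\<^sup>2 = (norm u)\<^sup>2 + (norm w)\<^sup>2"
      unfolding x using uw by (simp add: norm_add_Pythagorean orthogonal_def)
    have nu: "norm u \<le> norm x" and nw: "norm w \<le> norm x"
      by (rule power2_le_imp_le; simp add: nx)+
    have Dx: "(norm (D *v x))\<^sup>2 \<le> (norm x)\<^sup>2 - \<kappa> * (norm w)\<^sup>2"
    proof -
      have "(norm (D *v x))\<^sup>2 = (\<Sum>j\<in>UNIV. (D $ j $ j)\<^sup>2 * (x $ j)\<^sup>2)"
        unfolding power2_norm_eq_inner inner_vec_def
        by (simp add: diagonal_mult_vec[OF D] power2_eq_square algebra_simps)
      also have "\<dots> \<le> (\<Sum>j\<in>UNIV. (x $ j)\<^sup>2 - \<kappa> * (w $ j)\<^sup>2)"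
      proof (rule sum_mono)
        fix j
        show "(D $ j $ j)\<^sup>2 * (x $ j)\<^sup>2 \<le> (x $ j)\<^sup>2 - \<kappa> * (w $ j)\<^sup>2"
        proof (cases "j \<in> P")
          case True
          then have "(D $ j $ j)\<^sup>2 = 1" using unit[of j] by (metis power2_abs one_power2)
          then show ?thesis using True by (simp add: w_def)
        next
          case False
          have "(D $ j $ j)\<^sup>2 * (x $ j)\<^sup>2 \<le> (1 - \<kappa>) * (x $ j)\<^sup>2"
            using D_off[OF False] by (rule mult_right_mono) simp
          then show ?thesis using False by (simp add: w_def algebra_simps)
        qed
      qed
      also have "\<dots> = (norm x)\<^sup>2 - \<kappa> * (norm w)\<^sup>2"
        unfolding power2_norm_eq_inner inner_vec_def
        by (simp add: sum_subtractf sum_distrib_left power2_eq_square)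
      finally show ?thesis .
    qed
    have DuTu: "(D *v u) \<bullet> (T *v u) = t * (norm u)\<^sup>2"
    proof -
      have "(D *v u) \<bullet> (T *v u) = (\<Sum>j\<in>UNIV. \<Sum>k\<in>UNIV. (D $ j $ j * T $ j $ k) * (u $ j * u $ k))"
        by (simp add: inner_vec_def diagonal_mult_vec[OF D])
           (simp add: matrix_vector_mult_def sum_distrib_left algebra_simps)
      also have "\<dots> = (\<Sum>j\<in>UNIV. \<Sum>k\<in>UNIV. if j = k then t * (u $ j * u $ k) else 0)"
      proof (intro sum.cong refl)
        fix j k
        show "(D $ j $ j * T $ j $ k) * (u $ j * u $ k) = (if j = k then t * (u $ j * u $ k) else 0)"
          by (cases "j \<in> P \<and> k \<in> P") (simp add: block, auto simp: u_def)
      qed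
      also have "\<dots> = t * (norm u)\<^sup>2"
        by (simp add: power2_norm_eq_inner inner_vec_def sum_distrib_left)
      finally show ?thesis .
    qed
    have "\<bar>(D *v u) \<bullet> (T *v w)\<bar> \<le> norm x * (C * norm w)"
      by (rule order_trans[OF Cauchy_Schwarz_ineq2])
         (intro mult_mono C order_trans[OF D_contr] nu, auto)
    moreover have "\<bar>(D *v w) \<bullet> (T *v x)\<bar> \<le> norm w * (C * norm x)"
      by (rule order_trans[OF Cauchy_Schwarz_ineq2]) (intro mult_mono C D_contr, auto)
    moreover have "(D *v x) \<bullet> (T *v x)
        = (D *v u) \<bullet> (T *v u) + (D *v u) \<bullet> (T *v w) + (D *v w) \<bullet> (T *v x)"
      unfolding x by (simp add: matrix_vector_right_distrib inner_add_left inner_add_right)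
    ultimately have cross: "\<bar>(D *v x) \<bullet> (T *v x) - t * ((norm x)\<^sup>2 - (norm w)\<^sup>2)\<bar>
        \<le> 2 * C * norm x * norm w"
      using DuTu nx by (simp add: algebra_simps)
    have Tx: "(norm (T *v x))\<^sup>2 \<le> C\<^sup>2 * (norm x)\<^sup>2"
      using C[of x] by (metis norm_ge_zero power_mono power_mult_distrib)
    (* a and norm x will be the two variables of a quadratic form with leading term - \<kappa> * a^2 *)
    define a where "a = \<bar>\<rho>\<bar> * norm w"
    have "(norm ((\<rho> *\<^sub>R D - T) *v x))\<^sup>2
        = \<rho>\<^sup>2 * (norm (D *v x))\<^sup>2 - 2 * \<rho> * ((D *v x) \<bullet> (T *v x)) + (norm (T *v x))\<^sup>2"
      unfolding power2_norm_eq_inner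
      by (simp add: matrix_vector_mult_diff_rdistrib scaleR_matrix_vector_assoc[symmetric]
          inner_diff_left inner_diff_right inner_commute power2_eq_square algebra_simps)
    also have "\<dots> \<le> \<rho>\<^sup>2 * ((norm x)\<^sup>2 - \<kappa> * (norm w)\<^sup>2)
        - 2 * \<rho> * (t * ((norm x)\<^sup>2 - (norm w)\<^sup>2)) + 4 * C * norm x * a + C\<^sup>2 * (norm x)\<^sup>2"
    proof -
      define e where "e = (D *v x) \<bullet> (T *v x) - t * ((norm x)\<^sup>2 - (norm w)\<^sup>2)"
      have "- (2 * \<rho> * e) \<le> 2 * \<bar>\<rho>\<bar> * \<bar>e\<bar>"
        by (metis abs_ge_minus_self abs_mult abs_numeral)
      also have "\<dots> \<le> 2 * \<bar>\<rho>\<bar> * (2 * C * norm x * norm w)"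
        using cross by (intro mult_left_mono) (auto simp: e_def)
      finally have "- (2 * \<rho> * e) \<le> 4 * C * norm x * a"
        by (simp add: a_def algebra_simps)
      moreover have "\<rho>\<^sup>2 * (norm (D *v x))\<^sup>2 \<le> \<rho>\<^sup>2 * ((norm x)\<^sup>2 - \<kappa> * (norm w)\<^sup>2)"
        using Dx by (rule mult_left_mono) simp
      moreover have "2 * \<rho> * ((D *v x) \<bullet> (T *v x))
          = 2 * \<rho> * e + 2 * \<rho> * (t * ((norm x)\<^sup>2 - (norm w)\<^sup>2))"
        by (simp add: e_def algebra_simps)
      ultimately show ?thesis using Tx by linarith
    qed
    also have "\<dots> = (\<rho>\<^sup>2 - 2 * \<rho> * t + C\<^sup>2) * (norm x)\<^sup>2
        + (- \<kappa> * a\<^sup>2 + 2 * \<rho> * t * (norm w)\<^sup>2 + 4 * C * norm x * a)"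
      by (simp add: a_def power_mult_distrib algebra_simps)
    also have "\<dots> \<le> (\<rho>\<^sup>2 - 2 * \<rho> * t + C\<^sup>2) * (norm x)\<^sup>2 + (- \<kappa> * a\<^sup>2 + B * a * norm x)"
    proof -
      have "\<rho> * t * (norm w)\<^sup>2 \<le> \<bar>\<rho>\<bar> * \<bar>t\<bar> * (norm w * norm w)"
        unfolding power2_eq_square
        by (rule mult_right_mono) (metis abs_ge_self abs_mult, simp)
      also have "\<dots> \<le> \<bar>\<rho>\<bar> * \<bar>t\<bar> * (norm w * norm x)"
        using nw by (intro mult_left_mono) auto
      finally have "\<rho> * t * (norm w)\<^sup>2 \<le> \<bar>\<rho>\<bar> * \<bar>t\<bar> * (norm w * norm x)" .
      moreover have "B * a * norm x = 2 * (\<bar>\<rho>\<bar> * \<bar>t\<bar> * (norm w * norm x)) + 4 * C * norm x * a"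
        by (simp add: B_def a_def algebra_simps)
      ultimately show ?thesis by linarith
    qed
    also have "\<dots> \<le> (\<rho>\<^sup>2 - 2 * \<rho> * t + C\<^sup>2) * (norm x)\<^sup>2 + B\<^sup>2 / (4 * \<kappa>) * (norm x)\<^sup>2"
    proof -
      (* completing the square in a *)
      have "0 \<le> (2 * \<kappa> * a - B * norm x)\<^sup>2 / (4 * \<kappa>)" using \<kappa> by simp
      also have "\<dots> = (4 * \<kappa> * (\<kappa> * a\<^sup>2 - B * a * norm x) + B\<^sup>2 * (norm x)\<^sup>2) / (4 * \<kappa>)"
        by (simp add: power2_eq_square algebra_simps)
      also have "\<dots> = \<kappa> * a\<^sup>2 - B * a * norm x + B\<^sup>2 / (4 * \<kappa>) * (norm x)\<^sup>2"
        using \<kappa> by (simp add: add_divide_distrib)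
      finally show ?thesis by simp
    qed
    also have "\<dots> \<le> ((\<rho> - t)\<^sup>2 + K) * (norm x)\<^sup>2"
    proof -
      have "\<rho>\<^sup>2 - 2 * \<rho> * t + C\<^sup>2 + B\<^sup>2 / (4 * \<kappa>) \<le> (\<rho> - t)\<^sup>2 + K"
        by (simp add: K_def power2_diff)
      then show ?thesis by (metis distrib_right mult_right_mono zero_le_power2)
    qed
    finally show ?thesis .
  qed
  have "(op_norm (\<rho> *\<^sub>R D - T))\<^sup>2 \<le> (\<rho> - t)\<^sup>2 + K" for \<rho>
  proof -
    have "op_norm (\<rho> *\<^sub>R D - T) \<le> sqrt ((\<rho> - t)\<^sup>2 + K)"
    proof (rule op_norm_le)
      fix x
      show "norm ((\<rho> *\<^sub>R D - T) *v x) \<le> sqrt ((\<rho> - t)\<^sup>2 + K) * norm x"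
      proof (rule power2_le_imp_le)
        show "(norm ((\<rho> *\<^sub>R D - T) *v x))\<^sup>2 \<le> (sqrt ((\<rho> - t)\<^sup>2 + K) * norm x)\<^sup>2"
          using main[of \<rho> x] K by (simp add: power_mult_distrib)
      qed (use K in simp)
    qed
    moreover have "0 \<le> op_norm (\<rho> *\<^sub>R D - T)"
      unfolding op_norm_def by (rule onorm_pos_le) simp
    ultimately have "(op_norm (\<rho> *\<^sub>R D - T))\<^sup>2 \<le> (sqrt ((\<rho> - t)\<^sup>2 + K))\<^sup>2"
      by (intro power_mono)
    then show ?thesis using K by simp
  qed
  then show ?thesis by (rule that)
qed

section \<open>Independent families of diagonal matrices\<close>

locale independent_diagonal_family =
  fixes A :: "'m::finite \<Rightarrow> real^'n^'n"
  assumes diag: "\<And>k. A k \<in> diagonal_matrices"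
    and inj_family: "inj A"
    and independent_family: "independent (range A)"
begin

abbreviation "v \<equiv> ith_component A"

definition comb :: "real^'m \<Rightarrow> real^'n^'n" where
  "comb \<beta> = (\<Sum>k\<in>UNIV. \<beta> $ k *\<^sub>R A k)"

lemma linear_comb: "linear comb"
  unfolding comb_def
  by (intro linearI) (simp_all add: scaleR_add_left sum.distrib scaleR_sum_right)

lemma comb_component: "comb \<beta> $ j $ k = (\<Sum>l\<in>UNIV. \<beta> $ l * A l $ j $ k)"
  by (simp add: comb_def)

lemma comb_diagonal: "comb \<beta> \<in> diagonal_matrices"
  using diag by (simp add: diagonal_matrices_def comb_component)

lemma comb_entry: "comb \<beta> $ j $ j = \<beta> \<bullet> v j"
  by (simp add: comb_component inner_vec_def ith_component_def)

lemma comb_eq_0_iff: "comb \<beta> = 0 \<longleftrightarrow> \<beta> = 0"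
proof
  assume 0: "comb \<beta> = 0"
  have "(\<Sum>M\<in>range A. \<beta> $ inv A M *\<^sub>R M) = 0"
    using 0 inj_family by (simp add: comb_def sum.reindex inv_f_f)
  then have "\<beta> $ inv A (A k) = 0" for k
    using independentD[OF independent_family, of "range A" "\<lambda>M. \<beta> $ inv A M" "A k"] by simp
  then show "\<beta> = 0" using inj_family by (simp add: vec_eq_iff inv_f_f)
qed (simp add: comb_def)

lemma inner_components_eq_0:
  assumes "\<And>j. \<beta> \<bullet> v j = 0"
  shows "\<beta> = 0"
proof -
  have "comb \<beta> = 0"
    using comb_diagonal[of \<beta>] assms comb_entry[of \<beta>]
    by (metis (mono_tags, lifting) diagonal_matrices_def mem_Collect_eq vec_eq_iff zero_index)
  then show ?thesis by (simp add: comb_eq_0_iff)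
qed

lemma span_range: "span (range A) = range comb"
proof
  show "range comb \<subseteq> span (range A)"
    unfolding comb_def by (intro image_subsetI span_sum span_scale span_base rangeI)
  have "A k = comb (axis k 1)" for k
    by (simp add: comb_def axis_def if_distrib if_distribR cong: if_cong)
  then have "range A \<subseteq> range comb" by auto
  moreover have "subspace (range comb)"
    using linear_comb by (intro linear_subspace_image) auto
  ultimately show "span (range A) \<subseteq> range comb" by (rule span_minimal)
qed

lemma op_norm_comb_le:
  assumes "\<And>j. \<bar>\<beta> \<bullet> v j\<bar> \<le> q"
  shows "op_norm (comb \<beta>) \<le> q"
  using assms by (intro op_norm_diagonal_le comb_diagonal) (simp add: comb_entry)

lemma abs_inner_le_op_norm_comb: "\<bar>\<beta> \<bullet> v j\<bar> \<le> op_norm (comb \<beta>)"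
  using abs_diagonal_entry_le_op_norm[of "comb \<beta>" j] by (simp add: comb_entry)

subsection \<open>The star property singles out enough components to compute norms\<close>

abbreviation "P j \<equiv> P_plus A j \<union> P_minus A j"

lemma P_iff: "k \<in> P j \<longleftrightarrow> equivalent_components A j k"
  by (auto simp: P_plus_def P_minus_def equivalent_components_def)

lemma equivalent_abs_inner:
  "equivalent_components A j k \<Longrightarrow> \<bar>\<beta> \<bullet> v j\<bar> = \<bar>\<beta> \<bullet> v k\<bar>"
  by (auto simp: equivalent_components_def)

lemma star_propertyI:
  assumes "\<And>k. \<not> equivalent_components A j k \<Longrightarrow> \<bar>\<beta> \<bullet> v k\<bar> < \<bar>\<beta> \<bullet> v j\<bar>"
  shows "star_property A j"
  unfolding star_property_def
proof (cases "- P j = {}")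
  case False
  have "Max ((\<lambda>k. \<bar>\<Sum>l\<in>UNIV. \<beta> $ l * v k $ l\<bar>) ` (- P j)) < \<bar>\<Sum>l\<in>UNIV. \<beta> $ l * v j $ l\<bar>"
    using False assms P_iff by (subst Max_less_iff) (auto simp: inner_vec_def)
  then show "- P j = {} \<or> (\<exists>\<beta>. \<bar>\<Sum>l\<in>UNIV. \<beta> l * v j $ l\<bar>
      > Max ((\<lambda>k. \<bar>\<Sum>l\<in>UNIV. \<beta> l * v k $ l\<bar>) ` (- P j)))"
    by blast
qed simp

text \<open>
  When all components are equivalent, the star property holds by convention and provides no \<open>\<beta>\<close>;
  a peak then exists because independence prevents the components from all being zero.
\<close>

lemma star_property_peak:
  assumes "star_property A j"
  obtains \<beta> where "\<beta> \<bullet> v j = 1"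
    and "\<And>k. \<not> equivalent_components A j k \<Longrightarrow> \<bar>\<beta> \<bullet> v k\<bar> < 1"
proof -
  obtain \<gamma> where \<gamma>: "\<gamma> \<bullet> v j \<noteq> 0"
    and lt: "\<And>k. \<not> equivalent_components A j k \<Longrightarrow> \<bar>\<gamma> \<bullet> v k\<bar> < \<bar>\<gamma> \<bullet> v j\<bar>"
  proof (cases "- P j = {}")
    case True
    then have all: "equivalent_components A j k" for k using P_iff by blast
    have "\<exists>\<gamma>. \<gamma> \<bullet> v j \<noteq> 0"
    proof (rule ccontr)
      assume "\<not> ?thesis"
      then have "(axis k 1 :: real^'m) = 0" for k
        using equivalent_abs_inner[OF all] by (intro inner_components_eq_0) (metis abs_eq_0)
      then show False by (simp add: axis_eq_0_iff)
    qed
    then show ?thesis using that all by blast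
  next
    case False
    then obtain b where b: "Max ((\<lambda>k. \<bar>\<Sum>l\<in>UNIV. b l * v k $ l\<bar>) ` (- P j)) < \<bar>\<Sum>l\<in>UNIV. b l * v j $ l\<bar>"
      using assms unfolding star_property_def by blast
    have lt: "\<bar>vec_lambda b \<bullet> v k\<bar> < \<bar>vec_lambda b \<bullet> v j\<bar>" if "k \<in> - P j" for k
      using b that by (subst (asm) Max_less_iff) (auto simp: inner_vec_def)
    moreover obtain k where "k \<in> - P j" using False by blast
    ultimately have "vec_lambda b \<bullet> v j \<noteq> 0" by fastforce
    then show ?thesis using that[of "vec_lambda b"] lt P_iff by blast
  qed
  show ?thesis
  proof (rule that)
    show "((1 / (\<gamma> \<bullet> v j)) *\<^sub>R \<gamma>) \<bullet> v j = 1" using \<gamma> by simp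
    show "\<bar>((1 / (\<gamma> \<bullet> v j)) *\<^sub>R \<gamma>) \<bullet> v k\<bar> < 1" if "\<not> equivalent_components A j k" for k
      using \<gamma> lt[OF that] by simp
  qed
qed

text \<open>
  For \<open>\<beta>\<close> off finitely many hyperplanes, nonequivalent components have different values
  \<open>\<bar>\<beta> \<bullet> v\<^sub>j\<bar>\<close>, so that any maximiser has the star property.  The set of \<open>\<beta>\<close> whose maximum is attained at
  a star component is closed, and its complement lies in the hyperplanes, which contain no
  nonempty open set.
\<close>

lemma star_component_dominates:
  "\<exists>j. star_property A j \<and> (\<forall>k. \<bar>\<beta> \<bullet> v k\<bar> \<le> \<bar>\<beta> \<bullet> v j\<bar>)"
proof -
  define S where "S = (\<Union>j\<in>Collect (star_property A). \<Inter>k. {\<beta>. \<bar>\<beta> \<bullet> v k\<bar> \<le> \<bar>\<beta> \<bullet> v j\<bar>})"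
  have "closed S"
    unfolding S_def by (intro closed_UN closed_INT ballI closed_Collect_le continuous_intros) auto
  define H where "H = (\<Union>(j, k)\<in>{(j, k). \<not> equivalent_components A j k}.
    {\<beta>. (v j - v k) \<bullet> \<beta> = 0} \<union> {\<beta>. (v j + v k) \<bullet> \<beta> = 0})"
  have "negligible H"
    unfolding H_def
  proof (intro negligible_Union finite_imageI)
    fix X assume "X \<in> (\<lambda>(j, k). {\<beta>. (v j - v k) \<bullet> \<beta> = 0} \<union> {\<beta>. (v j + v k) \<bullet> \<beta> = 0}) `
      {(j, k). \<not> equivalent_components A j k}"
    then obtain j k where "\<not> equivalent_components A j k"
      and X: "X = {\<beta>. (v j - v k) \<bullet> \<beta> = 0} \<union> {\<beta>. (v j + v k) \<bullet> \<beta> = 0}" by auto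
    then have "v j - v k \<noteq> 0" "v j + v k \<noteq> 0"
      by (auto simp: equivalent_components_def eq_neg_iff_add_eq_0)
    then show "negligible X" unfolding X by (intro negligible_Un negligible_hyperplane) auto
  qed auto
  have "\<beta> \<in> S" if "\<beta> \<notin> H" for \<beta>
  proof -
    have "\<exists>j. \<forall>k. \<bar>\<beta> \<bullet> v k\<bar> \<le> \<bar>\<beta> \<bullet> v j\<bar>"
    proof -
      have "Max (range (\<lambda>k. \<bar>\<beta> \<bullet> v k\<bar>)) \<in> range (\<lambda>k. \<bar>\<beta> \<bullet> v k\<bar>)" by (intro Max_in) auto
      then obtain j where "Max (range (\<lambda>k. \<bar>\<beta> \<bullet> v k\<bar>)) = \<bar>\<beta> \<bullet> v j\<bar>" by (elim imageE)
      then show ?thesis by (metis Max_ge finite finite_imageI rangeI)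
    qed
    then obtain j where j: "\<bar>\<beta> \<bullet> v k\<bar> \<le> \<bar>\<beta> \<bullet> v j\<bar>" for k by blast
    have "\<bar>\<beta> \<bullet> v k\<bar> < \<bar>\<beta> \<bullet> v j\<bar>" if "\<not> equivalent_components A j k" for k
    proof -
      have "(v j - v k) \<bullet> \<beta> \<noteq> 0" "(v j + v k) \<bullet> \<beta> \<noteq> 0"
        using \<open>\<beta> \<notin> H\<close> that unfolding H_def by blast+
      then have "\<bar>\<beta> \<bullet> v k\<bar> \<noteq> \<bar>\<beta> \<bullet> v j\<bar>"
        by (auto simp: abs_eq_iff inner_commute algebra_simps)
      then show ?thesis using j[of k] by simp
    qed
    then have "star_property A j" by (rule star_propertyI)
    then show ?thesis using j by (auto simp: S_def)
  qed
  then have "- S \<subseteq> H" by blast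
  then have "negligible (- S)" using \<open>negligible H\<close> negligible_subset by blast
  then have "- S = {}" using open_not_negligible \<open>closed S\<close> by (metis open_Compl)
  then have "\<beta> \<in> S" by blast
  then show ?thesis by (auto simp: S_def)
qed

subsection \<open>Best coapproximations\<close>

text \<open>
  For every \<open>\<beta>\<close> the norm of \<open>comb (c - \<beta>)\<close> is attained at an entry in \<open>R\<close>, where it is also an entry
  of \<open>T - comb \<beta>\<close>.
\<close>

lemma best_coapproximation_combI:
  assumes dom: "\<And>\<beta> k. \<exists>r\<in>R. \<bar>\<beta> \<bullet> v k\<bar> \<le> \<bar>\<beta> \<bullet> v r\<bar>"
    and c: "\<And>r. r \<in> R \<Longrightarrow> c \<bullet> v r = T $ r $ r"
  shows "best_coapproximation op_norm (span (range A)) T (comb c)"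
  unfolding best_coapproximation_def span_range
proof (intro conjI ballI)
  fix y assume "y \<in> range comb"
  then obtain \<beta> where y: "y = comb \<beta>" by auto
  have "op_norm (comb (c - \<beta>)) \<le> op_norm (T - y)"
  proof (rule op_norm_comb_le)
    fix k
    obtain r where "r \<in> R" and r: "\<bar>(c - \<beta>) \<bullet> v k\<bar> \<le> \<bar>(c - \<beta>) \<bullet> v r\<bar>" using dom by blast
    note r
    also have "(c - \<beta>) \<bullet> v r = (T - y) $ r $ r"
      using c[OF \<open>r \<in> R\<close>] by (simp add: y comb_entry inner_diff_left)
    also have "\<bar>\<dots>\<bar> \<le> op_norm (T - y)" by (rule abs_diagonal_entry_le_op_norm)
    finally show "\<bar>(c - \<beta>) \<bullet> v k\<bar> \<le> op_norm (T - y)" .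
  qed
  then show "op_norm (comb c - y) \<le> op_norm (T - y)"
    by (simp add: y linear_diff[OF linear_comb])
qed auto

text \<open>
  Test the coapproximation inequality against the multiples \<open>\<rho> \<beta>\<close> of a peak vector \<open>\<beta>\<close> for \<open>j\<close>, with
  \<open>\<rho>\<close> of either sign.  If \<open>P j = {j}\<close>, then \<open>t = T $ j $ j\<close> meets the hypotheses for every \<open>T\<close>; on a
  larger class \<open>T\<close> has to follow the signs of its members.
\<close>

lemma best_coapproximation_forced:
  assumes star: "star_property A j"
    and coapprox: "best_coapproximation op_norm (span (range A)) T (comb c)"
    and plus: "\<And>k. v k = v j \<Longrightarrow> T $ k $ k = t"
    and minus: "\<And>k. v k = - v j \<Longrightarrow> T $ k $ k = - t"
    and off: "\<And>k l. k \<in> P j \<Longrightarrow> l \<in> P j \<Longrightarrow> k \<noteq> l \<Longrightarrow> T $ k $ l = 0"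
  shows "c \<bullet> v j = t"
proof -
  obtain \<beta> where \<beta>: "\<beta> \<bullet> v j = 1"
    and lt: "\<And>k. \<not> equivalent_components A j k \<Longrightarrow> \<bar>\<beta> \<bullet> v k\<bar> < 1"
    using star_property_peak[OF star] by blast
  obtain K where K: "\<And>\<rho>. (op_norm (\<rho> *\<^sub>R comb \<beta> - T))\<^sup>2 \<le> (\<rho> - t)\<^sup>2 + K"
  proof (rule op_norm_scaled_diagonal_minus[of "comb \<beta>" "P j" T t])
    show "\<bar>comb \<beta> $ k $ k\<bar> = 1" if "k \<in> P j" for k
      using equivalent_abs_inner[of j k \<beta>] that \<beta> P_iff[of k j] by (simp add: comb_entry)
    show "\<bar>comb \<beta> $ k $ k\<bar> < 1" if "k \<notin> P j" for k
      using lt that P_iff[of k j] by (simp add: comb_entry)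
    show "comb \<beta> $ k $ k * T $ k $ l = (if k = l then t else 0)" if "k \<in> P j" "l \<in> P j" for k l
      using that off[OF that] plus[of k] minus[of k] \<beta>
      by (auto simp: comb_entry P_plus_def P_minus_def)
  qed (use comb_diagonal in auto)
  have le: "(\<rho> - c \<bullet> v j)\<^sup>2 \<le> (\<rho> - t)\<^sup>2 + K" for \<rho>
  proof -
    have "\<bar>(c - \<rho> *\<^sub>R \<beta>) \<bullet> v j\<bar> \<le> op_norm (comb (c - \<rho> *\<^sub>R \<beta>))"
      by (rule abs_inner_le_op_norm_comb)
    also have "\<dots> = op_norm (comb c - comb (\<rho> *\<^sub>R \<beta>))"
      by (simp add: linear_diff[OF linear_comb])
    also have "\<dots> \<le> op_norm (T - comb (\<rho> *\<^sub>R \<beta>))"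
      using coapprox by (auto simp: best_coapproximation_def span_range)
    also have "\<dots> = op_norm (\<rho> *\<^sub>R comb \<beta> - T)"
      using onorm_neg[of "\<lambda>x. (\<rho> *\<^sub>R comb \<beta> - T) *v x"]
      by (simp add: op_norm_def linear_cmul[OF linear_comb] matrix_vector_mult_diff_rdistrib)
    finally have "\<bar>\<rho> - c \<bullet> v j\<bar> \<le> op_norm (\<rho> *\<^sub>R comb \<beta> - T)"
      using \<beta> by (simp add: inner_diff_left abs_minus_commute)
    then have "(\<rho> - c \<bullet> v j)\<^sup>2 \<le> (op_norm (\<rho> *\<^sub>R comb \<beta> - T))\<^sup>2"
      by (metis abs_ge_zero power2_abs power_mono)
    then show ?thesis using K order_trans by blast
  qed
  show ?thesis
  proof (rule ccontr)
    define d where "d = c \<bullet> v j"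
    assume "c \<bullet> v j \<noteq> t"
    then have "t - d \<noteq> 0" by (simp add: d_def)
    (* where the affine function 2 * \<rho> * (t - d) exceeds its alleged bound by 1 *)
    define \<rho> where "\<rho> = (t\<^sup>2 - d\<^sup>2 + K + 1) / (2 * (t - d))"
    have "\<rho> * (2 * (t - d)) = t\<^sup>2 - d\<^sup>2 + K + 1"
      using \<open>t - d \<noteq> 0\<close> by (intro iffD1[OF nonzero_eq_divide_eq \<rho>_def]) simp
    moreover have "\<rho> * (2 * (t - d)) \<le> t\<^sup>2 - d\<^sup>2 + K"
      using le[of \<rho>] by (simp add: d_def power2_diff algebra_simps)
    ultimately show False by simp
  qed
qed

end

section \<open>Complete lists of nonequivalent star components\<close>

locale star_representatives = independent_diagonal_family A
  for A :: "'m::finite \<Rightarrow> real^'n^'n" +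
  fixes p :: nat and i :: "nat \<Rightarrow> 'n"
  assumes star: "\<And>s. s \<in> {1..p} \<Longrightarrow> star_property A (i s)"
    and noneq: "\<And>s t. s \<in> {1..p} \<Longrightarrow> t \<in> {1..p} \<Longrightarrow> s \<noteq> t \<Longrightarrow>
                  \<not> equivalent_components A (i s) (i t)"
    and complete: "\<And>j. star_property A j \<Longrightarrow> \<exists>s\<in>{1..p}. equivalent_components A j (i s)"
begin

abbreviation "vertices \<equiv> (\<lambda>s. v (i s)) ` {1..p}"

lemma vertex_dominates: "\<exists>s\<in>{1..p}. \<bar>\<beta> \<bullet> v k\<bar> \<le> \<bar>\<beta> \<bullet> v (i s)\<bar>"
  using star_component_dominates[of \<beta>] complete equivalent_abs_inner by metis

lemma inj_on_vertices: "inj_on (\<lambda>s. v (i s)) {1..p}"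
  using noneq unfolding inj_on_def equivalent_components_def by blast

lemma card_vertices: "card vertices = p"
  using card_image[OF inj_on_vertices] by simp

lemma inner_vertices_eq_0:
  assumes "\<And>s. s \<in> {1..p} \<Longrightarrow> \<beta> \<bullet> v (i s) = 0"
  shows "\<beta> = 0"
proof (rule inner_components_eq_0)
  show "\<beta> \<bullet> v j = 0" for j using vertex_dominates[of \<beta> j] assms by auto
qed

lemma span_vertices: "span vertices = UNIV"
proof (rule ccontr)
  assume "span vertices \<noteq> UNIV"
  then obtain a where "a \<noteq> 0" and a: "\<And>x. x \<in> span vertices \<Longrightarrow> a \<bullet> x = 0"
    using span_not_UNIV_orthogonal by blast
  have "a = 0" by (rule inner_vertices_eq_0) (intro a span_base imageI)
  with \<open>a \<noteq> 0\<close> show False by contradiction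
qed

lemma vertices_at_least: "CARD('m) \<le> p"
  using dim_le_card[of UNIV vertices] span_vertices card_vertices
  by (simp only: dim_UNIV) simp

text \<open>
  The dual vector is read off a best coapproximation to the diagonal matrix that carries the signs
  \<open>\<plusminus>1\<close> on the class of \<open>i s\<close> and vanishes elsewhere: its values at all vertices are forced.
\<close>

lemma coproximinal_imp_dual_vector:
  assumes "coproximinal op_norm (span (range A))" and s: "s \<in> {1..p}"
  obtains c where "c \<bullet> v (i s) = 1"
    and "\<And>t. t \<in> {1..p} \<Longrightarrow> t \<noteq> s \<Longrightarrow> c \<bullet> v (i t) = 0"
proof -
  obtain \<beta> where "\<beta> \<bullet> v (i s) = 1" using star_property_peak[OF star[OF s]] by blast
  then have neg: "v (i s) \<noteq> - v (i s)" by (metis inner_minus_right one_neq_neg_one)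
  define T :: "real^'n^'n" where "T = (\<chi> j k. if j \<noteq> k then 0
    else if v j = v (i s) then 1 else if v j = - v (i s) then - 1 else 0)"
  obtain y where "best_coapproximation op_norm (span (range A)) T y"
    using assms(1) by (auto simp: coproximinal_def)
  moreover then obtain c where "y = comb c"
    by (auto simp: best_coapproximation_def span_range)
  ultimately have c: "best_coapproximation op_norm (span (range A)) T (comb c)" by simp
  show ?thesis
  proof (rule that)
    show "c \<bullet> v (i s) = 1"
      using neg by (intro best_coapproximation_forced[OF star[OF s] c]) (auto simp: T_def)
    show "c \<bullet> v (i t) = 0" if t: "t \<in> {1..p}" "t \<noteq> s" for t
    proof (rule best_coapproximation_forced[OF star[OF t(1)] c])
      have "v (i t) \<noteq> v (i s)" "v (i t) \<noteq> - v (i s)"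
        using noneq[OF t(1) s t(2)] by (auto simp: equivalent_components_def)
      then show "T $ k $ k = 0" if "v k = v (i t)" for k
        using that by (simp add: T_def)
      show "T $ k $ k = - 0" if "v k = - v (i t)" for k
        using that \<open>v (i t) \<noteq> v (i s)\<close> \<open>v (i t) \<noteq> - v (i s)\<close>
        by (auto simp: T_def minus_equation_iff[of "v (i t)"])
    qed (simp add: T_def)
  qed
qed

lemma coproximinal_imp_vertices_at_most:
  assumes "coproximinal op_norm (span (range A))"
  shows "p \<le> CARD('m)"
proof -
  have "independent vertices"
    unfolding independent_explicit_finite_subsets
  proof (intro allI impI ballI)
    fix S u x
    assume "S \<subseteq> vertices" "finite S" and 0: "(\<Sum>x\<in>S. u x *\<^sub>R x) = 0" and "x \<in> S"
    then obtain s where s: "s \<in> {1..p}" "x = v (i s)" by blast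
    obtain c where c: "c \<bullet> v (i s) = 1"
      and c0: "\<And>t. t \<in> {1..p} \<Longrightarrow> t \<noteq> s \<Longrightarrow> c \<bullet> v (i t) = 0"
      using coproximinal_imp_dual_vector[OF assms s(1)] by blast
    have c': "c \<bullet> y = (if y = x then 1 else 0)" if "y \<in> S" for y
    proof -
      obtain t where t: "t \<in> {1..p}" "y = v (i t)"
        using \<open>y \<in> S\<close> \<open>S \<subseteq> vertices\<close> by blast
      then show ?thesis using c c0[OF t(1)] s(2) by (cases "t = s") auto
    qed
    have "0 = c \<bullet> (\<Sum>x\<in>S. u x *\<^sub>R x)" using 0 by simp
    also have "\<dots> = (\<Sum>y\<in>S. if y = x then u y else 0)"
      by (simp add: inner_sum_right c' if_distrib cong: sum.cong if_cong)
    also have "\<dots> = u x" using \<open>finite S\<close> \<open>x \<in> S\<close> by simp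
    finally show "u x = 0" by simp
  qed
  then have "card vertices \<le> DIM(real^'m)" by (rule independent_bound[THEN conjunct2])
  then show ?thesis using card_vertices by simp
qed

text \<open>
  If \<open>j\<close> is another member of the class of \<open>i s\<close>, the norm can be computed without the index \<open>i s\<close>,
  so 0 is a best coapproximation to the matrix unit at \<open>(i s, i s)\<close>.  The vector dual to the vertex
  \<open>v (i s)\<close> gives a second one.
\<close>

lemma co_Chebyshev_imp_singleton_class:
  assumes "co_Chebyshev op_norm (span (range A))" and s: "s \<in> {1..p}"
  shows "P (i s) = {i s}"
proof (rule ccontr)
  assume "P (i s) \<noteq> {i s}"
  then obtain j where "j \<noteq> i s" "equivalent_components A (i s) j"
    using P_iff[of _ "i s"] by (auto simp: P_plus_def)
  define E :: "real^'n^'n" where "E = (\<chi> k l. if k = i s \<and> l = i s then 1 else 0)"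
  obtain c where c: "c \<bullet> v (i s) = 1"
    and c0: "\<And>t. t \<in> {1..p} \<Longrightarrow> t \<noteq> s \<Longrightarrow> c \<bullet> v (i t) = 0"
    using coproximinal_imp_dual_vector[OF _ s] assms(1) by (auto simp: co_Chebyshev_def)
  have "best_coapproximation op_norm (span (range A)) E (comb c)"
  proof (rule best_coapproximation_combI[of "i ` {1..p}"])
    fix r assume "r \<in> i ` {1..p}"
    then obtain t where t: "t \<in> {1..p}" "r = i t" by blast
    moreover have "i t \<noteq> i s" if "t \<noteq> s"
      using noneq[OF t(1) s that] by (auto simp: equivalent_components_def)
    ultimately show "c \<bullet> v r = E $ r $ r" using c c0 by (auto simp: E_def)
  qed (use vertex_dominates in blast)
  moreover have "best_coapproximation op_norm (span (range A)) E (comb 0)"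
  proof (rule best_coapproximation_combI[of "- {i s}"])
    show "\<exists>r\<in>- {i s}. \<bar>\<beta> \<bullet> v k\<bar> \<le> \<bar>\<beta> \<bullet> v r\<bar>" for \<beta> k
      using \<open>j \<noteq> i s\<close> equivalent_abs_inner[OF \<open>equivalent_components A (i s) j\<close>, of \<beta>]
      by (cases "k = i s") auto
  qed (auto simp: E_def)
  ultimately have "comb c = comb 0"
    using assms(1) unfolding co_Chebyshev_def by blast
  then have "c = 0" using comb_eq_0_iff by (simp add: linear_0[OF linear_comb])
  then show False using c by simp
qed

lemma co_ChebyshevI:
  assumes "p \<le> CARD('m)" and single: "\<And>s. s \<in> {1..p} \<Longrightarrow> P (i s) = {i s}"
  shows "co_Chebyshev op_norm (span (range A))"
proof -
  let ?Y = "span (range A)"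
  have "independent vertices"
    using card_vertices assms(1) span_vertices
    by (intro card_le_dim_spanning[of _ UNIV]) auto
  have ex: "\<exists>y. best_coapproximation op_norm ?Y T y" for T
  proof -
    obtain g :: "real^'m \<Rightarrow> real" where g: "linear g"
      and gv: "\<And>x. x \<in> vertices \<Longrightarrow> g x = (let j = i (inv_into {1..p} (\<lambda>s. v (i s)) x) in T $ j $ j)"
      using linear_independent_extend[OF \<open>independent vertices\<close>,
          of "\<lambda>x. let j = i (inv_into {1..p} (\<lambda>s. v (i s)) x) in T $ j $ j"] by blast
    (* adjoint g 1 is the vector that represents the functional g as an inner product *)
    have "adjoint g 1 \<bullet> v (i s) = T $ i s $ i s" if s: "s \<in> {1..p}" for s
    proof -
      have "adjoint g 1 \<bullet> v (i s) = g (v (i s))"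
        using adjoint_works[OF g, of "v (i s)" 1] by (simp add: inner_commute)
      then show ?thesis using gv[of "v (i s)"] s inv_into_f_f[OF inj_on_vertices s] by (simp add: Let_def)
    qed
    then have "best_coapproximation op_norm ?Y T (comb (adjoint g 1))"
      using vertex_dominates by (intro best_coapproximation_combI[of "i ` {1..p}"]) auto
    then show ?thesis by blast
  qed
  moreover have "y = z" if y: "best_coapproximation op_norm ?Y T y"
    and z: "best_coapproximation op_norm ?Y T z" for T y z
  proof -
    obtain c d where cd: "y = comb c" "z = comb d"
      using y z by (auto simp: best_coapproximation_def span_range)
    have forced: "e \<bullet> v (i s) = T $ i s $ i s"
      if e: "best_coapproximation op_norm ?Y T (comb e)" and s: "s \<in> {1..p}" for e s
    proof (rule best_coapproximation_forced[OF star[OF s] e])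
      show "T $ k $ k = T $ i s $ i s" if "v k = v (i s)" for k
      proof -
        have "k \<in> P (i s)" using that by (simp add: P_plus_def)
        then show ?thesis using single[OF s] by simp
      qed
      show "T $ k $ k = - T $ i s $ i s" if "v k = - v (i s)" for k
      proof -
        (* this case is void: v k = - v k contradicts the existence of a peak *)
        have "k \<in> P (i s)" using that by (simp add: P_minus_def)
        then have "k = i s" using single[OF s] by simp
        moreover obtain \<beta> where "\<beta> \<bullet> v (i s) = 1" using star_property_peak[OF star[OF s]] by blast
        ultimately show ?thesis using that by (metis inner_minus_right one_neq_neg_one)
      qed
      show "T $ k $ l = 0" if "k \<in> P (i s)" "l \<in> P (i s)" "k \<noteq> l" for k l
        using that single[OF s] by simp
    qed
    have "c - d = 0"
      using forced y z unfolding cd by (intro inner_vertices_eq_0) (simp add: inner_diff_left)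
    then show ?thesis by (simp add: cd)
  qed
  ultimately show ?thesis
    unfolding co_Chebyshev_def coproximinal_def
    by (intro conjI allI ex_ex1I subspace_span) blast+
qed

end

theorem theorem2p16:
  fixes A :: "'m::finite \<Rightarrow> real^'n^'n"
    and p :: nat
    and i :: "nat \<Rightarrow> 'n"
  assumes diag: "\<And>k. A k \<in> diagonal_matrices"
    and lin_indep: "inj A" "independent (range A)"
    and star: "\<And>s. s \<in> {1..p} \<Longrightarrow> star_property A (i s)"
    and noneq: "\<And>s t. s \<in> {1..p} \<Longrightarrow> t \<in> {1..p} \<Longrightarrow> s \<noteq> t \<Longrightarrow>
                  \<not> equivalent_components A (i s) (i t)"
    and complete: "\<And>j. star_property A j \<Longrightarrow> \<exists>s\<in>{1..p}. equivalent_components A j (i s)"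
  shows "co_Chebyshev op_norm (span (range A)) \<longleftrightarrow>
         p = CARD('m) \<and> (\<forall>s\<in>{1..p}. card (P_plus A (i s) \<union> P_minus A (i s)) = 1)"
proof -
  interpret star_representatives A p i
    by (unfold_locales; fact)
  have card_iff: "card (P (i s)) = 1 \<longleftrightarrow> P (i s) = {i s}" for s
  proof -
    have "card X = 1 \<longleftrightarrow> X = {x}" if "x \<in> X" for X and x :: 'n
      using that by (auto simp: card_1_singleton_iff)
    then show ?thesis by (simp add: P_plus_def)
  qed
  show ?thesis
  proof
    assume cC: "co_Chebyshev op_norm (span (range A))"
    then have "p \<le> CARD('m)"
      using coproximinal_imp_vertices_at_most by (auto simp: co_Chebyshev_def)
    then show "p = CARD('m) \<and> (\<forall>s\<in>{1..p}. card (P (i s)) = 1)"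
      using vertices_at_least co_Chebyshev_imp_singleton_class[OF cC] card_iff by auto
  next
    assume "p = CARD('m) \<and> (\<forall>s\<in>{1..p}. card (P (i s)) = 1)"
    then show "co_Chebyshev op_norm (span (range A))"
      using card_iff by (intro co_ChebyshevI) auto
  qed
qed

end
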